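(* Let $G=A\rtimes K$ with $A$ and $K$ finite abelian groups, and assume $\gcd(|A|,|K|)=1$. Then for every $r\ge 1$, \[ |\mathrm{Hom}(\mathbb Z^r,G)|=\sum_{B\le K}|A:C_B|\,|C_B|^r\,\varphi_r(B) =|A|\sum_{B\le K}|C_B|^{r-1}\,\varphi_r(B). \] Equivalently, \[ |\mathrm{Hom}(\mathbb Z^r,G)|=\sum_{B\le K}\sum_{D\le B}|A:C_B|\,\mu_B(D)\,(|C_B|\,|D|)^r, \] and \[ N_{\max}(G)=\sum_{\substack{B\le K\\ |C_B|\,|B|=m(G)}}|A:C_B|. \]
   Context: $A$ is the normal factor of $A\rtimes K$. For $B\le K$, $C_B:=\mathrm{C}_A(B)$ is the subgroup of elements of $A$ fixed by every element of $B$ under the action of $K$ on $A$; $\varphi_r(B)$ is the number of $r$-tuples $(b_1,\dots,b_r)\in B^r$ with $\langle b_1,\dots,b_r\rangle=B$; $\mu_B(D):=\mu(D,B)$ is the Möbius function of the subgroup lattice interval $[D,B]$. $\mathrm{Hom}(\mathbb Z^r,G)$ is the set of pairwise commuting $r$-tuples in $G^r$. $m(G)$ is the maximum order of an abelian subgroup of $G$, and $N_{\max}(G)$ is the number of abelian subgroups of $G$ of order $m(G)$. *)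

theory Defs
  imports "HOL-Algebra.Algebra"
begin

definition semidirect ::
  "('a, 'm) monoid_scheme \<Rightarrow> ('b \<Rightarrow> 'a \<Rightarrow> 'a) \<Rightarrow> ('b, 'n) monoid_scheme \<Rightarrow> ('a \<times> 'b) monoid"
  where "semidirect A \<theta> K =
    \<lparr>carrier = carrier A \<times> carrier K,
     monoid.mult = (\<lambda>(a, k) (a', k'). (a \<otimes>\<^bsub>A\<^esub> \<theta> k a', k \<otimes>\<^bsub>K\<^esub> k')),
     one = (\<one>\<^bsub>A\<^esub>, \<one>\<^bsub>K\<^esub>)\<rparr>"

text \<open>The subgroup \<open>C\<^sub>A(B)\<close> of elements of \<open>A\<close> fixed by \<open>B\<close> under the action \<open>\<theta>\<close>.\<close>

definition fixed_points ::
  "('a, 'm) monoid_scheme \<Rightarrow> ('b \<Rightarrow> 'a \<Rightarrow> 'a) \<Rightarrow> 'b set \<Rightarrow> 'a set"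
  where "fixed_points A \<theta> B = {a \<in> carrier A. \<forall>b\<in>B. \<theta> b a = a}"

definition subgroup_index :: "('a, 'm) monoid_scheme \<Rightarrow> 'a set \<Rightarrow> nat"
  where "subgroup_index G H = card (rcosets\<^bsub>G\<^esub> H)"

text \<open>Elements of \<open>G\<^sup>r\<close> are represented by lists of length \<open>r\<close>.\<close>

definition commuting_tuples :: "nat \<Rightarrow> ('a, 'm) monoid_scheme \<Rightarrow> 'a list set"
  where "commuting_tuples r G =
    {xs. length xs = r \<and> set xs \<subseteq> carrier G \<and>
         (\<forall>i<r. \<forall>j<r. xs ! i \<otimes>\<^bsub>G\<^esub> xs ! j = xs ! j \<otimes>\<^bsub>G\<^esub> xs ! i)}"

text \<open>The Eulerian function \<open>\<phi>\<^sub>r(B)\<close>, for a subgroup \<open>B\<close> of \<open>K\<close>.\<close>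

definition num_generating_tuples :: "('b, 'n) monoid_scheme \<Rightarrow> nat \<Rightarrow> 'b set \<Rightarrow> nat"
  where "num_generating_tuples K r B =
    card {bs. length bs = r \<and> set bs \<subseteq> B \<and> generate K (set bs) = B}"

text \<open>
  The Moebius function \<open>\<mu>(D, B)\<close> of the subgroup lattice, through the usual recursion
  \<open>\<mu>(D, D) = 1\<close> and \<open>\<mu>(D, B) = - (\<Sum>D \<le> E < B. \<mu>(D, E))\<close> for \<open>D < B\<close>. The finiteness guard
  makes the recursion terminate.
\<close>

function subgroup_moebius :: "('b, 'n) monoid_scheme \<Rightarrow> 'b set \<Rightarrow> 'b set \<Rightarrow> int"
  where "subgroup_moebius K D B =
    (if finite B \<and> D \<subseteq> B
     then if D = B then 1
          else - (\<Sum>E \<in> {E. subgroup E K \<and> D \<subseteq> E \<and> E \<subset> B}. subgroup_moebius K D E)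
     else 0)"
  by auto
termination
  by (relation "measure (\<lambda>(K, D, B). card B)") (auto intro: psubset_card_mono)

declare subgroup_moebius.simps [simp del]

definition abelian_subgroups :: "('a, 'm) monoid_scheme \<Rightarrow> 'a set set"
  where "abelian_subgroups G = {H. subgroup H G \<and> comm_group (G\<lparr>carrier := H\<rparr>)}"

definition max_abelian_order :: "('a, 'm) monoid_scheme \<Rightarrow> nat"
  where "max_abelian_order G = Max (card ` abelian_subgroups G)"

definition num_max_abelian :: "('a, 'm) monoid_scheme \<Rightarrow> nat"
  where "num_max_abelian G = card {H \<in> abelian_subgroups G. card H = max_abelian_order G}"

lemma semidirect_group:
  fixes A :: "('a, 'm) monoid_scheme" and K :: "('b, 'n) monoid_scheme"
  assumes "group A" and "group K" and \<theta>: "\<theta> \<in> hom K (AutoGroup A)"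
  shows "group (semidirect A \<theta> K)"
proof -
  interpret A: group A by fact
  interpret K: group K by fact
  interpret h: group_hom K "AutoGroup A" \<theta>
    using \<theta> A.AutoGroup by (simp add: group_hom_def group_hom_axioms_def K.is_group)
  have aut: "\<theta> k \<in> auto A" if "k \<in> carrier K" for k
    using h.hom_closed [OF that] by (simp add: AutoGroup_def)
  have closed: "\<theta> k a \<in> carrier A" if "k \<in> carrier K" "a \<in> carrier A" for k a
    using aut [OF that(1)] that(2) by (auto simp: auto_def hom_def)
  have mult: "\<theta> k (a \<otimes>\<^bsub>A\<^esub> b) = \<theta> k a \<otimes>\<^bsub>A\<^esub> \<theta> k b"
    if "k \<in> carrier K" "a \<in> carrier A" "b \<in> carrier A" for k a b
    using aut [OF that(1)] that by (auto simp: auto_def hom_def)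
  have act: "\<theta> (k \<otimes>\<^bsub>K\<^esub> l) a = \<theta> k (\<theta> l a)"
    if "k \<in> carrier K" "l \<in> carrier K" "a \<in> carrier A" for k l a
    using h.hom_mult [OF that(1,2)] aut [OF that(1)] aut [OF that(2)] that(3)
    by (simp add: AutoGroup_def BijGroup_def auto_def compose_eq)
  have one: "\<theta> \<one>\<^bsub>K\<^esub> a = a" if "a \<in> carrier A" for a
    using h.hom_one that by (simp add: AutoGroup_def BijGroup_def)
  show ?thesis
  proof (rule groupI)
    fix x assume "x \<in> carrier (semidirect A \<theta> K)"
    then obtain a k where x: "x = (a, k)" "a \<in> carrier A" "k \<in> carrier K"
      by (auto simp: semidirect_def)
    let ?y = "(\<theta> (inv\<^bsub>K\<^esub> k) (inv\<^bsub>A\<^esub> a), inv\<^bsub>K\<^esub> k)"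
    have "\<theta> (inv\<^bsub>K\<^esub> k) (inv\<^bsub>A\<^esub> a) \<otimes>\<^bsub>A\<^esub> \<theta> (inv\<^bsub>K\<^esub> k) a = \<theta> (inv\<^bsub>K\<^esub> k) \<one>\<^bsub>A\<^esub>"
      using x mult [of "inv\<^bsub>K\<^esub> k" "inv\<^bsub>A\<^esub> a" a] by (simp del: h.hom_inv)
    also have "\<dots> = \<one>\<^bsub>A\<^esub>"
      using x mult [of "inv\<^bsub>K\<^esub> k" "\<one>\<^bsub>A\<^esub>" "\<one>\<^bsub>A\<^esub>"] closed [of "inv\<^bsub>K\<^esub> k" "\<one>\<^bsub>A\<^esub>"] by (simp del: h.hom_inv)
    finally show "\<exists>y\<in>carrier (semidirect A \<theta> K).
        y \<otimes>\<^bsub>semidirect A \<theta> K\<^esub> x = \<one>\<^bsub>semidirect A \<theta> K\<^esub>"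
      using x by (intro bexI [of _ ?y]) (auto simp: semidirect_def closed simp del: h.hom_inv)
  qed (auto simp: semidirect_def closed mult act one A.m_assoc K.m_assoc
      simp del: h.hom_mult h.hom_one)
qed

end

theory Submission
  imports Defs "HOL-Number_Theory.Cong"
begin

text \<open>
  Let \<open>H\<close> be an abelian subgroup of \<open>A \<rtimes> K\<close> with projection \<open>B\<close> to \<open>K\<close>. Averaging the commutation
  relations over \<open>B\<close>, which is possible because \<open>|B|\<close> is prime to \<open>|A|\<close>, produces \<open>t \<in> A\<close> such that
  \<open>H\<close> lies in the conjugate of the abelian group \<open>C\<^sub>B \<times> B\<close> by \<open>t\<close>. This conjugate depends exactly on
  the coset of \<open>t\<close> modulo \<open>C\<^sub>B\<close>, so there are \<open>|A : C\<^sub>B|\<close> of them. A commuting tuple whose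
  projection generates \<open>B\<close> lies in exactly one of these conjugates, which gives the count of tuples;
  and the abelian subgroups of maximal order are themselves such conjugates.
\<close>

section \<open>Groups and their subgroup lattices\<close>

text \<open>Sending \<open>f x\<close> to \<open>g x\<close> is a well-defined bijection between the
  images. It later matches conjugates with cosets.\<close>

lemma card_image_eq_if_same_kernel:
  assumes "\<And>x y. x \<in> U \<Longrightarrow> y \<in> U \<Longrightarrow> f x = f y \<longleftrightarrow> g x = g y"
  shows "card (f ` U) = card (g ` U)"
proof -
  define h where "h y = g (SOME x. x \<in> U \<and> f x = y)" for y
  have h: "h (f x) = g x" if "x \<in> U" for x
  proof -
    have "(SOME z. z \<in> U \<and> f z = f x) \<in> U \<and> f (SOME z. z \<in> U \<and> f z = f x) = f x"
      using that by (intro someI [where P = "\<lambda>z. z \<in> U \<and> f z = f x"]) simp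
    with assms that show ?thesis
      unfolding h_def by blast
  qed
  have "bij_betw h (f ` U) (g ` U)"
    unfolding bij_betw_def inj_on_def using h assms by (auto simp: image_image)
  then show ?thesis
    by (rule bij_betw_same_card)
qed

text \<open>Centralizers being subgroups, commutation extends from generators to everything they
  generate.\<close>

lemma (in group) subgroup_centralizer:
  assumes "S \<subseteq> carrier G"
  shows "subgroup {x \<in> carrier G. \<forall>s\<in>S. x \<otimes> s = s \<otimes> x} G"
proof (rule subgroupI)
  fix x assume x: "x \<in> {x \<in> carrier G. \<forall>s\<in>S. x \<otimes> s = s \<otimes> x}"
  have "inv x \<otimes> s = s \<otimes> inv x" if "s \<in> S" for s
  proof -
    have s: "s \<in> carrier G" "x \<in> carrier G" "x \<otimes> s = s \<otimes> x"
      using assms that x by auto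
    then have "inv x \<otimes> s = inv x \<otimes> (s \<otimes> x) \<otimes> inv x"
      by (simp add: m_assoc)
    also have "\<dots> = inv x \<otimes> (x \<otimes> s) \<otimes> inv x"
      using s by simp
    also have "\<dots> = s \<otimes> inv x"
      using s(1,2) by (simp add: m_assoc [symmetric])
    finally show ?thesis .
  qed
  with x show "inv x \<in> {x \<in> carrier G. \<forall>s\<in>S. x \<otimes> s = s \<otimes> x}"
    by auto
next
  fix x y
  assume x: "x \<in> {x \<in> carrier G. \<forall>s\<in>S. x \<otimes> s = s \<otimes> x}"
    and y: "y \<in> {x \<in> carrier G. \<forall>s\<in>S. x \<otimes> s = s \<otimes> x}"
  have "x \<otimes> y \<otimes> s = s \<otimes> (x \<otimes> y)" if "s \<in> S" for s
  proof -
    have s: "s \<in> carrier G" "x \<in> carrier G" "y \<in> carrier G" "x \<otimes> s = s \<otimes> x" "y \<otimes> s = s \<otimes> y"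
      using assms that x y by auto
    have "x \<otimes> y \<otimes> s = x \<otimes> (y \<otimes> s)"
      using s(1-3) by (simp add: m_assoc)
    also have "\<dots> = x \<otimes> s \<otimes> y"
      using s(1-3) by (simp add: s(5) m_assoc)
    also have "\<dots> = s \<otimes> (x \<otimes> y)"
      using s(1-3) by (simp add: s(4) m_assoc)
    finally show ?thesis .
  qed
  with x y show "x \<otimes> y \<in> {x \<in> carrier G. \<forall>s\<in>S. x \<otimes> s = s \<otimes> x}"
    by auto
next
  have "\<one> \<in> {x \<in> carrier G. \<forall>s\<in>S. x \<otimes> s = s \<otimes> x}"
    using assms by auto
  then show "{x \<in> carrier G. \<forall>s\<in>S. x \<otimes> s = s \<otimes> x} \<noteq> {}"
    by blast
qed auto

text \<open>Two passes through centralizers: \<open>generate G S\<close> centralizes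
  \<open>S\<close>, hence \<open>S\<close> centralizes \<open>generate G S\<close>, and therefore so
  does \<open>generate G S\<close> itself.\<close>

lemma (in group) generate_pairwise_commute:
  assumes S: "S \<subseteq> carrier G"
    and comm: "\<And>x y. x \<in> S \<Longrightarrow> y \<in> S \<Longrightarrow> x \<otimes> y = y \<otimes> x"
    and "x \<in> generate G S" "y \<in> generate G S"
  shows "x \<otimes> y = y \<otimes> x"
proof -
  have "generate G S \<subseteq> {x \<in> carrier G. \<forall>s\<in>S. x \<otimes> s = s \<otimes> x}"
    by (rule generate_subgroup_incl [OF _ subgroup_centralizer [OF S]]) (use S comm in auto)
  then have "S \<subseteq> {x \<in> carrier G. \<forall>s\<in>generate G S. x \<otimes> s = s \<otimes> x}"
    using S by auto
  then have "generate G S \<subseteq> {x \<in> carrier G. \<forall>s\<in>generate G S. x \<otimes> s = s \<otimes> x}"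
    by (rule generate_subgroup_incl [OF _ subgroup_centralizer [OF generate_incl [OF S]]])
  with assms(3,4) show ?thesis
    by auto
qed

lemma (in group) abelian_subgroups_iff:
  "H \<in> abelian_subgroups G \<longleftrightarrow> subgroup H G \<and> (\<forall>x\<in>H. \<forall>y\<in>H. x \<otimes> y = y \<otimes> x)"
proof
  assume "H \<in> abelian_subgroups G"
  then show "subgroup H G \<and> (\<forall>x\<in>H. \<forall>y\<in>H. x \<otimes> y = y \<otimes> x)"
    using comm_groupE(4) [of "G\<lparr>carrier := H\<rparr>"] by (auto simp: abelian_subgroups_def)
next
  assume H: "subgroup H G \<and> (\<forall>x\<in>H. \<forall>y\<in>H. x \<otimes> y = y \<otimes> x)"
  then interpret H: group "G\<lparr>carrier := H\<rparr>"
    by (simp add: subgroup_imp_group)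
  show "H \<in> abelian_subgroups G"
    using H by (auto simp: abelian_subgroups_def intro: H.group_comm_groupI)
qed

lemma (in group) finite_subgroups:
  assumes "finite (carrier G)"
  shows "finite {H. subgroup H G}"
  by (rule finite_subset [of _ "Pow (carrier G)"]) (use assms subgroup.subset in auto)

lemma commuting_tuples_iff:
  "xs \<in> commuting_tuples r G \<longleftrightarrow> length xs = r \<and> set xs \<subseteq> carrier G \<and>
    (\<forall>x\<in>set xs. \<forall>y\<in>set xs. x \<otimes>\<^bsub>G\<^esub> y = y \<otimes>\<^bsub>G\<^esub> x)"
  unfolding commuting_tuples_def by (force simp: in_set_conv_nth)

section \<open>Generating tuples and Moebius inversion in the subgroup lattice\<close>

text \<open>Sort the \<open>r\<close>-tuples over \<open>U\<close> by the subgroup that they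
  generate.\<close>

lemma (in group) sum_num_generating_tuples:
  assumes fin: "finite (carrier G)" and U: "subgroup U G"
  shows "(\<Sum>B \<in> {B. subgroup B G \<and> B \<subseteq> U}. num_generating_tuples G r B) = card U ^ r"
proof -
  let ?T = "\<lambda>B. {bs. length bs = r \<and> set bs \<subseteq> B \<and> generate G (set bs) = B}"
  have finU: "finite U"
    using fin U finite_subset subgroup.subset by blast
  have "{bs. set bs \<subseteq> U \<and> length bs = r} = (\<Union>B \<in> {B. subgroup B G \<and> B \<subseteq> U}. ?T B)"
  proof (intro equalityI subsetI)
    fix bs assume bs: "bs \<in> {bs. set bs \<subseteq> U \<and> length bs = r}"
    then have "set bs \<subseteq> carrier G"
      using subgroup.subset [OF U] by auto
    then have "subgroup (generate G (set bs)) G" "generate G (set bs) \<subseteq> U"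
      using bs generate_is_subgroup generate_subgroup_incl [OF _ U] by auto
    with bs show "bs \<in> (\<Union>B \<in> {B. subgroup B G \<and> B \<subseteq> U}. ?T B)"
      using generate.incl by fastforce
  qed auto
  then have "card U ^ r = card (\<Union>B \<in> {B. subgroup B G \<and> B \<subseteq> U}. ?T B)"
    using card_lists_length_eq [OF finU, of r] by simp
  also have "\<dots> = (\<Sum>B \<in> {B. subgroup B G \<and> B \<subseteq> U}. card (?T B))"
  proof (rule card_UN_disjoint)
    show "finite {B. subgroup B G \<and> B \<subseteq> U}"
      using finU by simp
    show "\<forall>B \<in> {B. subgroup B G \<and> B \<subseteq> U}. finite (?T B)"
    proof
      fix B assume "B \<in> {B. subgroup B G \<and> B \<subseteq> U}"
      then show "finite (?T B)"
        by (intro finite_subset [OF _ finite_lists_length_eq [OF finU, of r]]) auto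
    qed
  qed auto
  finally show ?thesis
    by (simp add: num_generating_tuples_def)
qed

text \<open>For \<open>D \<noteq> U\<close> this is the defining recursion with the top term
  \<open>E = U\<close> brought to the side of the sum.\<close>

lemma (in group) sum_subgroup_moebius:
  assumes fin: "finite (carrier G)" and D: "subgroup D G" and U: "subgroup U G"
    and DU: "D \<subseteq> U"
  shows "(\<Sum>E \<in> {E. subgroup E G \<and> D \<subseteq> E \<and> E \<subseteq> U}. subgroup_moebius G D E)
    = (if D = U then 1 else 0)"
proof -
  have finU: "finite U"
    using fin U finite_subset subgroup.subset by blast
  have *: "{E. subgroup E G \<and> D \<subseteq> E \<and> E \<subseteq> U} = insert U {E. subgroup E G \<and> D \<subseteq> E \<and> E \<subset> U}"
    using U DU by auto
  have "finite {E. subgroup E G \<and> D \<subseteq> E \<and> E \<subset> U}"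
    by (rule finite_subset [of _ "Pow U"]) (use finU in auto)
  then have "(\<Sum>E \<in> {E. subgroup E G \<and> D \<subseteq> E \<and> E \<subseteq> U}. subgroup_moebius G D E)
     = subgroup_moebius G D U + (\<Sum>E \<in> {E. subgroup E G \<and> D \<subseteq> E \<and> E \<subset> U}. subgroup_moebius G D E)"
    unfolding * by (subst sum.insert) auto
  \<comment> \<open>For \<open>D = U\<close> only the top term remains, and its value is 1.\<close>
  moreover have "{E. subgroup E G \<and> U \<subseteq> E \<and> E \<subset> U} = {}"
    by auto
  ultimately show ?thesis
    using finU DU subgroup_moebius.simps [of G D U] 
    by (cases "D = U") (simp_all only: sum.empty if_True if_False, simp_all)
qed

text \<open>Both sides have the same sums over the subgroups of any given subgroup, hence they agree;
  this avoids the dual recursion for the Moebius function.\<close>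

lemma (in group) num_generating_tuples_moebius:
  assumes fin: "finite (carrier G)" and "subgroup B G"
  shows "int (num_generating_tuples G r B)
    = (\<Sum>D \<in> {D. subgroup D G \<and> D \<subseteq> B}. subgroup_moebius G D B * int (card D) ^ r)"
proof -
  define \<psi> where
    "\<psi> B = (\<Sum>D \<in> {D. subgroup D G \<and> D \<subseteq> B}. subgroup_moebius G D B * int (card D) ^ r)" for B
  have finS: "finite {B. subgroup B G \<and> P B}" for P
    by (rule finite_subset [OF _ finite_subgroups [OF fin]]) auto
  have sum_psi: "(\<Sum>B \<in> {B. subgroup B G \<and> B \<subseteq> U}. \<psi> B) = int (card U) ^ r" if U: "subgroup U G" for U
  proof -
    \<comment> \<open>Since \<open>D \<subseteq> B \<subseteq> U\<close>, the inner index set is a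
      restriction of the subgroups of \<open>U\<close>, the form in which the two sums can be
      exchanged.\<close>
    have "(\<Sum>B \<in> {B. subgroup B G \<and> B \<subseteq> U}. \<psi> B)
      = (\<Sum>B \<in> {B. subgroup B G \<and> B \<subseteq> U}. \<Sum>D \<in> {D \<in> {D. subgroup D G \<and> D \<subseteq> U}. D \<subseteq> B}.
          subgroup_moebius G D B * int (card D) ^ r)"
      unfolding \<psi>_def by (intro sum.cong) auto
    also have "\<dots> = (\<Sum>D \<in> {D. subgroup D G \<and> D \<subseteq> U}. \<Sum>B \<in> {B \<in> {B. subgroup B G \<and> B \<subseteq> U}. D \<subseteq> B}.
          subgroup_moebius G D B * int (card D) ^ r)"
      by (rule sum.swap_restrict) (rule finS)+
    also have "\<dots> = (\<Sum>D \<in> {D. subgroup D G \<and> D \<subseteq> U}.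
        (\<Sum>B \<in> {B. subgroup B G \<and> D \<subseteq> B \<and> B \<subseteq> U}. subgroup_moebius G D B) * int (card D) ^ r)"
      by (auto simp: sum_distrib_right conj_ac intro!: sum.cong)
    \<comment> \<open>The inner Moebius sum over the interval from \<open>D\<close> to
      \<open>U\<close> vanishes unless \<open>D = U\<close>.\<close>
    also have "\<dots> = (\<Sum>D \<in> {D. subgroup D G \<and> D \<subseteq> U}. if D = U then int (card D) ^ r else 0)"
      using sum_subgroup_moebius [OF fin _ U] by (intro sum.cong) auto
    also have "\<dots> = int (card U) ^ r"
      using U finS by simp
    finally show ?thesis .
  qed
  have "finite B"
    using assms finite_subset subgroup.subset by blast
  then have "int (num_generating_tuples G r B) = \<psi> B"
    using \<open>subgroup B G\<close>
  proof (induction B rule: finite_psubset_induct)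
    case (psubset B)
    \<comment> \<open>Isolates the term of \<open>B\<close>: the totals over all subgroups of
      \<open>B\<close> agree, the proper subgroups agree by induction, so the terms of
      \<open>B\<close> agree.\<close>
    have split: "(\<Sum>E \<in> {E. subgroup E G \<and> E \<subseteq> B}. f E)
        = f B + (\<Sum>E \<in> {E. subgroup E G \<and> E \<subset> B}. f E)" for f :: "'a set \<Rightarrow> int"
    proof -
      have "{E. subgroup E G \<and> E \<subseteq> B} = insert B {E. subgroup E G \<and> E \<subset> B}"
        using psubset.prems by auto
      then show ?thesis
        using finS by simp
    qed
    have "(\<Sum>E \<in> {E. subgroup E G \<and> E \<subseteq> B}. int (num_generating_tuples G r E))
        = (\<Sum>E \<in> {E. subgroup E G \<and> E \<subseteq> B}. \<psi> E)"
      using sum_num_generating_tuples [OF fin psubset.prems, of r] sum_psi [OF psubset.prems]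
      by (simp flip: of_nat_sum)
    moreover have "(\<Sum>E \<in> {E. subgroup E G \<and> E \<subset> B}. int (num_generating_tuples G r E))
        = (\<Sum>E \<in> {E. subgroup E G \<and> E \<subset> B}. \<psi> E)"
      using psubset.IH by (intro sum.cong) auto
    ultimately show ?case
      by (simp add: split)
  qed
  then show ?thesis
    by (simp add: \<psi>_def)
qed

section \<open>Coprime actions and averaging\<close>

locale coprime_action = A: comm_group A + K: comm_group K
  for A :: "('a, 'm) monoid_scheme" (structure) and K :: "('b, 'n) monoid_scheme" +
  fixes \<theta> :: "'b \<Rightarrow> 'a \<Rightarrow> 'a"
  assumes finite_A: "finite (carrier A)" and finite_K: "finite (carrier K)"
    and action: "\<theta> \<in> hom K (AutoGroup A)"
    and coprime: "coprime (order A) (order K)"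
begin

section \<open>The action of \<open>K\<close> by automorphisms of \<open>A\<close> and its fixed
  points\<close>

abbreviation C :: "'b set \<Rightarrow> 'a set" where "C \<equiv> fixed_points A \<theta>"
abbreviation G :: "('a \<times> 'b) monoid" where "G \<equiv> semidirect A \<theta> K"

sublocale G: group G
  using semidirect_group action A.is_group K.is_group by blast

lemma act_auto: "k \<in> carrier K \<Longrightarrow> \<theta> k \<in> auto A"
  using action by (auto simp: hom_def AutoGroup_def)

lemma act_closed [simp]: "k \<in> carrier K \<Longrightarrow> a \<in> carrier A \<Longrightarrow> \<theta> k a \<in> carrier A"
  using act_auto [of k] by (auto simp: auto_def hom_def)

lemma act_mult:
  "k \<in> carrier K \<Longrightarrow> a \<in> carrier A \<Longrightarrow> b \<in> carrier A \<Longrightarrow> \<theta> k (a \<otimes> b) = \<theta> k a \<otimes> \<theta> k b"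
  using act_auto [of k] by (auto simp: auto_def hom_def)

lemma act_hom: "k \<in> carrier K \<Longrightarrow> group_hom A A (\<theta> k)"
  by (intro group_hom.intro group_hom_axioms.intro) (auto simp: hom_def act_mult)

lemma act_one [simp]: "k \<in> carrier K \<Longrightarrow> \<theta> k \<one> = \<one>"
  using group_hom.hom_one [OF act_hom] .

lemma act_inv: "k \<in> carrier K \<Longrightarrow> a \<in> carrier A \<Longrightarrow> \<theta> k (inv a) = inv (\<theta> k a)"
  using group_hom.hom_inv [OF act_hom] .

lemma act_pow: "k \<in> carrier K \<Longrightarrow> a \<in> carrier A \<Longrightarrow> \<theta> k (a [^] (n::nat)) = \<theta> k a [^] n"
  by (induction n) (auto simp: act_mult)

lemma act_finprod:
  assumes "k \<in> carrier K" "f \<in> S \<rightarrow> carrier A"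
  shows "\<theta> k (\<Otimes>i\<in>S. f i) = (\<Otimes>i\<in>S. \<theta> k (f i))"
  using assms(2)
proof (induction S rule: infinite_finite_induct)
  case (insert x S)
  then have "\<theta> k (\<Otimes>i\<in>insert x S. f i) = \<theta> k (f x) \<otimes> \<theta> k (\<Otimes>i\<in>S. f i)"
    using assms(1) by (simp add: act_mult Pi_iff)
  also have "\<dots> = \<theta> k (f x) \<otimes> (\<Otimes>i\<in>S. \<theta> k (f i))"
    using insert by simp
  also have "\<dots> = (\<Otimes>i\<in>insert x S. \<theta> k (f i))"
    using insert assms(1) by (subst A.finprod_insert) (auto simp: Pi_iff)
  finally show ?case .
qed (use assms(1) in auto)

lemma act_act:
  assumes "k \<in> carrier K" "l \<in> carrier K" "a \<in> carrier A"
  shows "\<theta> (k \<otimes>\<^bsub>K\<^esub> l) a = \<theta> k (\<theta> l a)"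
proof -
  have "\<theta> (k \<otimes>\<^bsub>K\<^esub> l) = \<theta> k \<otimes>\<^bsub>AutoGroup A\<^esub> \<theta> l"
    using action assms by (simp add: hom_def)
  then show ?thesis
    using act_auto [OF assms(1)] act_auto [OF assms(2)] assms(3)
    by (simp add: AutoGroup_def BijGroup_def auto_def compose_eq)
qed

lemma act_id [simp]: "a \<in> carrier A \<Longrightarrow> \<theta> \<one>\<^bsub>K\<^esub> a = a"
proof -
  assume a: "a \<in> carrier A"
  have "\<theta> \<one>\<^bsub>K\<^esub> = \<one>\<^bsub>AutoGroup A\<^esub>"
    using action by (intro hom_one [OF _ K.is_group A.AutoGroup])
  with a show ?thesis
    by (simp add: AutoGroup_def BijGroup_def)
qed

lemma subgroup_C:
  assumes "B \<subseteq> carrier K"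
  shows "subgroup (C B) A"
proof (rule A.subgroupI)
  show "C B \<noteq> {}"
    using assms by (auto simp: fixed_points_def intro!: exI [of _ \<one>])
qed (use assms in \<open>auto simp: fixed_points_def act_mult act_inv subset_iff\<close>)

lemma C_carrier: "c \<in> C B \<Longrightarrow> c \<in> carrier A"
  by (simp add: fixed_points_def)

lemma C_fixed: "c \<in> C B \<Longrightarrow> b \<in> B \<Longrightarrow> \<theta> b c = c"
  by (simp add: fixed_points_def)

lemma C_pow: "B \<subseteq> carrier K \<Longrightarrow> c \<in> C B \<Longrightarrow> c [^] (n::nat) \<in> C B"
  by (auto simp: fixed_points_def act_pow)

lemma C_finprod:
  assumes "B \<subseteq> carrier K" "f \<in> S \<rightarrow> C B"
  shows "(\<Otimes>i\<in>S. f i) \<in> C B"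
  using assms(2)
proof (induction S rule: infinite_finite_induct)
  case (insert x S)
  then have "f x \<in> C B" "(\<Otimes>i\<in>S. f i) \<in> C B" "f x \<in> carrier A" "f \<in> S \<rightarrow> carrier A"
    by (auto simp: C_carrier Pi_iff)
  with insert show ?case
    by (simp add: subgroup.m_closed [OF subgroup_C [OF assms(1)]])
qed (auto simp: subgroup.one_closed [OF subgroup_C [OF assms(1)]])

section \<open>Roots and norms\<close>

text \<open>\<open>card B\<close> divides \<open>order K\<close>, so it is prime to
  \<open>order A\<close>, and \<open>m\<close> is its inverse modulo \<open>order A\<close>. Raising
  to the power \<open>m\<close> thus extracts \<open>card B\<close>-th roots in
  \<open>A\<close>.\<close>

lemma exponent_root:
  assumes "subgroup B K"
  obtains m :: nat where "\<And>a. a \<in> carrier A \<Longrightarrow> (a [^] card B) [^] m = a"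
proof -
  have "card B dvd order K"
    using K.lagrange [OF assms] by (metis dvd_triv_right)
  then have "coprime (card B) (order A)"
    using coprime coprime_commute coprime_divisors dvd_refl by blast
  then obtain m where m: "[card B * m = 1] (mod order A)"
    using cong_solve_coprime_nat by (metis One_nat_def)
  have "(a [^] card B) [^] m = a" if a: "a \<in> carrier A" for a
  proof -
    have ord: "a [^] order A = \<one>"
      using a finite_A A.power_order_eq_one by (simp add: order_def)
    \<comment> \<open>As \<open>a [^] order A = \<one>\<close>, exponents matter only modulo
      \<open>order A\<close>.\<close>
    have red: "a [^] n = a [^] (n mod order A)" for n
    proof -
      have "a [^] n = a [^] (order A * (n div order A) + n mod order A)"
        by simp
      also have "\<dots> = (a [^] order A) [^] (n div order A) \<otimes> a [^] (n mod order A)"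
        using a by (simp only: A.nat_pow_mult A.nat_pow_pow)
      finally show ?thesis
        using a by (simp add: ord)
    qed
    have "(a [^] card B) [^] m = a [^] (card B * m)"
      using a by (simp add: A.nat_pow_pow)
    also have "\<dots> = a [^] (1::nat)"
      using m red [of "card B * m"] red [of 1] by (simp add: cong_def)
    finally show ?thesis
      using a by simp
  qed
  with that show thesis .
qed

text \<open>Applying \<open>\<theta> k\<close> with \<open>k \<in> B\<close> only permutes the
  factors, since left multiplication by \<open>k\<close> permutes \<open>B\<close>.\<close>

lemma norm_in_C:
  assumes B: "subgroup B K" and a: "a \<in> carrier A"
  shows "(\<Otimes>b\<in>B. \<theta> b a) \<in> C B"
proof -
  interpret B: subgroup B K by fact
  have "\<theta> k (\<Otimes>b\<in>B. \<theta> b a) = (\<Otimes>b\<in>B. \<theta> b a)" if k: "k \<in> B" for k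
  proof -
    have img: "(\<lambda>b. k \<otimes>\<^bsub>K\<^esub> b) ` B = B"
      using K.coset_join3 [of k B] k B by (auto simp: l_coset_def)
    have "\<theta> k (\<Otimes>b\<in>B. \<theta> b a) = (\<Otimes>b\<in>B. \<theta> k (\<theta> b a))"
      using a k by (intro act_finprod) auto
    also have "\<dots> = (\<Otimes>b\<in>B. \<theta> (k \<otimes>\<^bsub>K\<^esub> b) a)"
      using a k by (intro A.finprod_cong') (auto simp: act_act)
    also have "\<dots> = (\<Otimes>b\<in>(\<lambda>b. k \<otimes>\<^bsub>K\<^esub> b) ` B. \<theta> b a)"
      using a k by (intro A.finprod_reindex [symmetric]) (auto simp: inj_on_def)
    finally show ?thesis
      by (simp only: img)
  qed
  then show ?thesis
    using a by (auto simp: fixed_points_def intro!: A.finprod_closed)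
qed

section \<open>Coboundaries and the conjugates of \<open>C B \<times> B\<close>\<close>

text \<open>The \<open>A\<close>-component of the conjugate of \<open>(\<one>, b)\<close> by
  \<open>(t, \<one>)\<close> in the semidirect product.\<close>

definition coboundary :: "'a \<Rightarrow> 'b \<Rightarrow> 'a"
  where "coboundary t b = t \<otimes> inv (\<theta> b t)"

lemma coboundary_closed [simp]:
  "t \<in> carrier A \<Longrightarrow> b \<in> carrier K \<Longrightarrow> coboundary t b \<in> carrier A"
  by (simp add: coboundary_def)

text \<open>The crossed homomorphism (1-cocycle) identity: on the right, the inner factor
  \<open>\<theta> b t\<close> cancels against its inverse.\<close>

lemma coboundary_mult:
  assumes "t \<in> carrier A" "b \<in> carrier K" "b' \<in> carrier K"
  shows "coboundary t (b \<otimes>\<^bsub>K\<^esub> b') = coboundary t b \<otimes> \<theta> b (coboundary t b')"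
  using assms unfolding coboundary_def
  by (simp add: act_mult act_inv act_act A.m_assoc A.inv_solve_left)

text \<open>Multiplying \<open>u = coboundary u b \<otimes> \<theta> b u\<close> over
  \<open>b \<in> B\<close> writes \<open>u [^] card B\<close> as a product of elements of
  \<open>C B\<close> and a norm; the root is then taken inside \<open>C B\<close>. In other words,
  an element whose class modulo \<open>C B\<close> is fixed by \<open>B\<close> is itself
  fixed.\<close>

lemma coboundary_in_C_imp:
  assumes B: "subgroup B K" and u: "u \<in> carrier A"
    and cob: "\<And>b. b \<in> B \<Longrightarrow> coboundary u b \<in> C B"
  shows "u \<in> C B"
proof -
  interpret B: subgroup B K by fact
  obtain m :: nat where m: "\<And>a. a \<in> carrier A \<Longrightarrow> (a [^] card B) [^] m = a"
    using exponent_root [OF B] by blast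
  have "u [^] card B = (\<Otimes>b\<in>B. u)"
    using u by (simp add: A.finprod_const)
  also have "\<dots> = (\<Otimes>b\<in>B. coboundary u b \<otimes> \<theta> b u)"
    using u by (intro A.finprod_cong') (auto simp: coboundary_def A.m_assoc)
  also have "\<dots> = (\<Otimes>b\<in>B. coboundary u b) \<otimes> (\<Otimes>b\<in>B. \<theta> b u)"
    using u by (intro A.finprod_multf) auto
  also have "\<dots> \<in> C B"
    using cob
    by (intro subgroup.m_closed [OF subgroup_C [OF B.subset] C_finprod [OF B.subset] norm_in_C [OF B u]])
      auto
  finally have "(u [^] card B) [^] m \<in> C B"
    by (rule C_pow [OF B.subset])
  with m [OF u] show ?thesis
    by simp
qed

text \<open>The conjugate of \<open>C B \<times> B\<close> by \<open>t\<close>.\<close>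

definition twisted :: "'b set \<Rightarrow> 'a \<Rightarrow> ('a \<times> 'b) set"
  where "twisted B t = (\<lambda>(c, b). (c \<otimes> coboundary t b, b)) ` (C B \<times> B)"

text \<open>Averaging: multiply the commutation relation of a fixed \<open>(a, b)\<close> with one element of \<open>H\<close> over
  each \<open>b' \<in> B\<close>, and then extract the \<open>|B|\<close>-th root, which is possible by coprimality.\<close>

lemma commuting_subset_twisted:
  assumes B: "subgroup B K" and H: "H \<subseteq> carrier G" and proj: "snd ` H = B"
    and comm: "\<And>x y. x \<in> H \<Longrightarrow> y \<in> H \<Longrightarrow> x \<otimes>\<^bsub>G\<^esub> y = y \<otimes>\<^bsub>G\<^esub> x"
  obtains t where "t \<in> carrier A" "H \<subseteq> twisted B t"
proof -
  interpret B: subgroup B K by fact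
  obtain m :: nat where m: "\<And>a. a \<in> carrier A \<Longrightarrow> (a [^] card B) [^] m = a"
    using exponent_root [OF B] by blast
  \<comment> \<open>One element \<open>(f b, b)\<close> of \<open>H\<close> is chosen over each
    \<open>b \<in> B\<close>.\<close>
  have "\<exists>a. (a, b) \<in> H" if "b \<in> B" for b
    using that proj by force
  then obtain f where f: "\<And>b. b \<in> B \<Longrightarrow> (f b, b) \<in> H"
    by metis
  have fA: "f b \<in> carrier A" if "b \<in> B" for b
    using f [OF that] H by (auto simp: semidirect_def)
  define F where "F = (\<Otimes>b\<in>B. f b)"
  have F: "F \<in> carrier A"
    unfolding F_def using fA by (intro A.finprod_closed) auto
  \<comment> \<open>The \<open>card B\<close>-th root of the product of the chosen components. It
    does not depend on \<open>(a, b)\<close>, so one \<open>t\<close> serves all of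
    \<open>H\<close>.\<close>
  define t where "t = F [^] m"
  have t: "t \<in> carrier A"
    using F by (simp add: t_def)
  have "(a, b) \<in> twisted B t" if ab: "(a, b) \<in> H" for a b
  proof -
    have a: "a \<in> carrier A" and b: "b \<in> B"
      using ab H imageI [OF ab, of snd] proj by (auto simp: semidirect_def)
    define N where "N = (\<Otimes>b'\<in>B. \<theta> b' a)"
    have N: "N \<in> C B"
      unfolding N_def using norm_in_C [OF B a] .
    \<comment> \<open>The \<open>A\<close>-component of the commutation of \<open>(a, b)\<close>
      with \<open>(f b', b')\<close>.\<close>
    have eq: "a \<otimes> \<theta> b (f b') = f b' \<otimes> \<theta> b' a" if "b' \<in> B" for b'
      using comm [OF ab f [OF that]] by (simp add: semidirect_def)
    have "a [^] card B \<otimes> \<theta> b F = (\<Otimes>b'\<in>B. a) \<otimes> (\<Otimes>b'\<in>B. \<theta> b (f b'))"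
      unfolding F_def using a b fA by (subst act_finprod) (auto simp: A.finprod_const)
    also have "\<dots> = (\<Otimes>b'\<in>B. a \<otimes> \<theta> b (f b'))"
      using a b fA by (intro A.finprod_multf [symmetric]) auto
    also have "\<dots> = (\<Otimes>b'\<in>B. f b' \<otimes> \<theta> b' a)"
      using a b fA eq by (intro A.finprod_cong') auto
    also have "\<dots> = F \<otimes> N"
      unfolding F_def N_def using a fA by (intro A.finprod_multf) auto
    finally have "(a [^] card B \<otimes> \<theta> b F) [^] m = (F \<otimes> N) [^] m"
      by simp
    \<comment> \<open>The power \<open>m\<close> turns \<open>a [^] card B\<close> back into
      \<open>a\<close> and \<open>F\<close> into \<open>t\<close>, and it commutes with
      \<open>\<theta> b\<close>.\<close>
    then have "a \<otimes> \<theta> b t = t \<otimes> N [^] m"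
      using a b F C_carrier [OF N] by (simp add: A.nat_pow_distrib m act_pow t_def)
    then have "a = N [^] m \<otimes> coboundary t b"
      using a b t C_carrier [OF N] A.inv_solve_right [of a "t \<otimes> N [^] m" "\<theta> b t"]
      by (simp add: coboundary_def A.m_ac)
    then show ?thesis
      unfolding twisted_def using b C_pow [OF B.subset N, of m] by auto
  qed
  then have "H \<subseteq> twisted B t"
    by auto
  with t show thesis
    by (rule that)
qed

text \<open>\<open>\<theta> b\<close> fixes \<open>c'\<close>, and the coboundary factors combine by
  \<open>coboundary_mult\<close>. So the parametrization of \<open>twisted B t\<close> is
  multiplicative on the direct product \<open>C B \<times> B\<close>.\<close>

lemma twisted_mult:
  assumes B: "B \<subseteq> carrier K" and t: "t \<in> carrier A"
    and "c \<in> C B" "c' \<in> C B" "b \<in> B" "b' \<in> B"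
  shows "(c \<otimes> coboundary t b, b) \<otimes>\<^bsub>G\<^esub> (c' \<otimes> coboundary t b', b')
    = (c \<otimes> c' \<otimes> coboundary t (b \<otimes>\<^bsub>K\<^esub> b'), b \<otimes>\<^bsub>K\<^esub> b')"
proof -
  have "b \<in> carrier K" "b' \<in> carrier K" "c \<in> carrier A" "c' \<in> carrier A" "\<theta> b c' = c'"
    using assms by (auto simp: C_carrier C_fixed)
  with t show ?thesis
    by (simp add: semidirect_def act_mult coboundary_mult A.m_ac)
qed

lemma twisted_carrier:
  assumes "B \<subseteq> carrier K" "t \<in> carrier A"
  shows "twisted B t \<subseteq> carrier G"
  using assms by (auto simp: twisted_def semidirect_def C_carrier subset_iff)

text \<open>Closure, inverses and commutativity are carried over from the abelian group
  \<open>C B \<times> B\<close> by \<open>twisted_mult\<close>.\<close>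

lemma twisted_abelian:
  assumes B: "subgroup B K" and t: "t \<in> carrier A"
  shows "twisted B t \<in> abelian_subgroups G"
proof -
  interpret B: subgroup B K by fact
  interpret CB: subgroup "C B" A by (rule subgroup_C [OF B.subset])
  note mult = twisted_mult [OF B.subset t]
  have "subgroup (twisted B t) G"
  proof (rule G.subgroupI)
    show "twisted B t \<subseteq> carrier G"
      using twisted_carrier B.subset t .
    show "twisted B t \<noteq> {}"
      unfolding twisted_def using CB.one_closed B.one_closed by blast
  next
    fix x y assume "x \<in> twisted B t" "y \<in> twisted B t"
    then obtain c b c' b' where "c \<in> C B" "b \<in> B" "x = (c \<otimes> coboundary t b, b)"
      "c' \<in> C B" "b' \<in> B" "y = (c' \<otimes> coboundary t b', b')"
      by (auto simp: twisted_def)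
    then show "x \<otimes>\<^bsub>G\<^esub> y \<in> twisted B t"
      by (auto simp: twisted_def mult intro!: image_eqI [of _ _ "(c \<otimes> c', b \<otimes>\<^bsub>K\<^esub> b')"])
  next
    fix x assume x: "x \<in> twisted B t"
    then obtain c b where cb: "c \<in> C B" "b \<in> B" "x = (c \<otimes> coboundary t b, b)"
      by (auto simp: twisted_def)
    define y where "y = (inv c \<otimes> coboundary t (inv\<^bsub>K\<^esub> b), inv\<^bsub>K\<^esub> b)"
    have y: "y \<in> twisted B t"
      unfolding twisted_def y_def using cb by (intro image_eqI [of _ _ "(inv c, inv\<^bsub>K\<^esub> b)"]) auto
    have "y \<otimes>\<^bsub>G\<^esub> x = (inv c \<otimes> c \<otimes> coboundary t (inv\<^bsub>K\<^esub> b \<otimes>\<^bsub>K\<^esub> b), inv\<^bsub>K\<^esub> b \<otimes>\<^bsub>K\<^esub> b)"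
      unfolding y_def cb(3) using cb(1,2) by (intro mult) auto
    also have "\<dots> = \<one>\<^bsub>G\<^esub>"
      using cb(1,2) t by (simp add: semidirect_def coboundary_def)
    finally have "inv\<^bsub>G\<^esub> x = y"
      using x y twisted_carrier [OF B.subset t] by (intro G.inv_equality) auto
    with y show "inv\<^bsub>G\<^esub> x \<in> twisted B t"
      by simp
  qed
  moreover have "x \<otimes>\<^bsub>G\<^esub> y = y \<otimes>\<^bsub>G\<^esub> x" if "x \<in> twisted B t" "y \<in> twisted B t" for x y
    using that by (auto simp: twisted_def mult A.m_comm K.m_comm)
  ultimately show ?thesis
    by (simp add: G.abelian_subgroups_iff)
qed

text \<open>\<open>C B\<close> is nonempty, so every element of \<open>B\<close> occurs. Thus
  \<open>B\<close> can be read off from the conjugate.\<close>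

lemma snd_twisted:
  assumes "subgroup B K"
  shows "snd ` twisted B t = B"
proof -
  have "C B \<noteq> {}"
    using subgroup.one_closed [OF subgroup_C [OF subgroup.subset [OF assms]]] by auto
  then have "snd ` (C B \<times> B) = B"
    by simp
  then show ?thesis
    by (simp add: twisted_def image_image case_prod_unfold)
qed

lemma inj_on_twist:
  assumes "B \<subseteq> carrier K" "t \<in> carrier A"
  shows "inj_on (\<lambda>(c, b). (c \<otimes> coboundary t b, b)) (C B \<times> B)"
  using assms by (auto simp: inj_on_def C_carrier subset_iff)

lemma card_twisted:
  assumes "B \<subseteq> carrier K" "t \<in> carrier A"
  shows "card (twisted B t) = card (C B) * card B"
  unfolding twisted_def using card_image [OF inj_on_twist [OF assms]]
  by (simp add: card_cartesian_product)

section \<open>Counting\<close>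

text \<open>An element of \<open>I\<close> over \<open>b\<close> gives
  \<open>c \<otimes> coboundary t b = c' \<otimes> coboundary t' b\<close> with
  \<open>c, c' \<in> C B\<close>, so the coboundary of \<open>t \<otimes> inv t'\<close> at
  \<open>b\<close> is \<open>inv c \<otimes> c'\<close>. As \<open>I\<close> covers all of
  \<open>B\<close>, \<open>coboundary_in_C_imp\<close> applies.\<close>

lemma twisted_common:
  assumes B: "subgroup B K" and t: "t \<in> carrier A" "t' \<in> carrier A"
    and I: "I \<subseteq> twisted B t" "I \<subseteq> twisted B t'" "snd ` I = B"
  shows "t \<otimes> inv t' \<in> C B"
proof (rule coboundary_in_C_imp [OF B])
  fix b assume b: "b \<in> B"
  interpret B: subgroup B K by fact
  interpret CB: subgroup "C B" A by (rule subgroup_C [OF B.subset])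
  obtain a where a: "(a, b) \<in> I"
    using b I(3) by force
  then obtain c c' where c: "c \<in> C B" "c' \<in> C B"
    and eq: "a = c \<otimes> coboundary t b" "a = c' \<otimes> coboundary t' b"
    using I(1,2) by (force simp: twisted_def)
  have cA: "c \<in> carrier A" "c' \<in> carrier A" "b \<in> carrier K"
    using b c by (auto simp: C_carrier)
  have "coboundary (t \<otimes> inv t') b = coboundary t b \<otimes> inv (coboundary t' b)"
    using t cA by (simp add: coboundary_def act_mult act_inv A.inv_mult A.m_ac)
  also have "coboundary t b = inv c \<otimes> c' \<otimes> coboundary t' b"
    using eq t cA A.inv_solve_left [of "coboundary t b" c "c' \<otimes> coboundary t' b"]
    by (simp add: A.m_assoc)
  also have "inv c \<otimes> c' \<otimes> coboundary t' b \<otimes> inv (coboundary t' b) = inv c \<otimes> c'"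
    using t cA by (simp add: A.m_assoc)
  also have "\<dots> \<in> C B"
    using c by simp
  finally show "coboundary (t \<otimes> inv t') b \<in> C B" .
qed (use t in simp)

text \<open>Write \<open>t = c \<otimes> t'\<close> with \<open>c\<close> fixed by \<open>B\<close>:
  in the coboundary, \<open>c\<close> cancels, so \<open>t\<close> and \<open>t'\<close> have the
  same coboundary on \<open>B\<close>.\<close>

lemma twisted_cong:
  assumes B: "subgroup B K" and t: "t \<in> carrier A" "t' \<in> carrier A" and C: "t \<otimes> inv t' \<in> C B"
  shows "twisted B t = twisted B t'"
proof -
  interpret B: subgroup B K by fact
  have "coboundary t b = coboundary t' b" if b: "b \<in> B" for b
  proof -
    define c where "c = t \<otimes> inv t'"
    have c: "c \<in> carrier A" "\<theta> b c = c"
      using C b by (auto simp: c_def C_carrier C_fixed)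
    have "t = c \<otimes> t'"
      using t by (simp add: c_def A.m_assoc)
    then have "coboundary t b = c \<otimes> coboundary t' b \<otimes> inv c"
      unfolding coboundary_def
      using t(2) b c by (simp add: act_mult A.inv_mult A.m_ac)
    also have "\<dots> = coboundary t' b \<otimes> c \<otimes> inv c"
      using t b c by (simp add: A.m_comm)
    also have "\<dots> = coboundary t' b"
      using t b c by (simp add: A.m_assoc)
    finally show ?thesis .
  qed
  then show ?thesis
    unfolding twisted_def by (intro image_cong) auto
qed

text \<open>By \<open>twisted_common\<close> and \<open>twisted_cong\<close>, two elements give the
  same conjugate exactly when they lie in the same coset of \<open>C B\<close>.\<close>

lemma card_twisted_image:
  assumes B: "subgroup B K"
  shows "card (twisted B ` carrier A) = subgroup_index A (C B)"
proof -
  interpret B: subgroup B K by fact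
  interpret CB: subgroup "C B" A by (rule subgroup_C [OF B.subset])
  have "twisted B t = twisted B t' \<longleftrightarrow> C B #> t = C B #> t'"
    if t: "t \<in> carrier A" "t' \<in> carrier A" for t t'
  proof -
    have "twisted B t = twisted B t' \<longleftrightarrow> t \<otimes> inv t' \<in> C B"
      using twisted_common [OF B t, of "twisted B t"] twisted_cong [OF B t] snd_twisted [OF B]
      by auto
    also have "\<dots> \<longleftrightarrow> t \<in> C B #> t'"
      using t by (simp add: CB.rcos_module A.is_group)
    also have "\<dots> \<longleftrightarrow> C B #> t = C B #> t'"
      using A.repr_independence [OF _ t(2) CB.subgroup_axioms, of t]
        A.rcos_self [OF t(1) CB.subgroup_axioms] by auto
    finally show ?thesis .
  qed
  then have "card (twisted B ` carrier A) = card ((\<lambda>t. C B #> t) ` carrier A)"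
    by (rule card_image_eq_if_same_kernel)
  also have "(\<lambda>t. C B #> t) ` carrier A = rcosets (C B)"
    by (auto simp: RCOSETS_def)
  finally show ?thesis
    by (simp add: subgroup_index_def)
qed

section \<open>Commuting tuples\<close>

lemma snd_hom: "group_hom G K snd"
  by (intro group_hom.intro group_hom_axioms.intro G.is_group K.is_group)
    (auto simp: hom_def semidirect_def)

lemma finite_G: "finite (carrier G)"
  using finite_A finite_K by (simp add: semidirect_def)

text \<open>The argument is the conjugate \<open>H\<close> and not \<open>t\<close>, because
  different \<open>t\<close> may give the same conjugate and must not be counted twice.\<close>

definition twisted_tuples :: "nat \<Rightarrow> 'b set \<Rightarrow> ('a \<times> 'b) set \<Rightarrow> ('a \<times> 'b) list set"
  where "twisted_tuples r B H = {xs. length xs = r \<and> set xs \<subseteq> H \<and> generate K (snd ` set xs) = B}"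

lemma finite_twisted_tuples: "H \<subseteq> carrier G \<Longrightarrow> finite (twisted_tuples r B H)"
  by (rule finite_subset [OF _ finite_lists_length_eq [OF finite_subset [OF _ finite_G], of H r]])
    (auto simp: twisted_tuples_def)

text \<open>Entrywise, such a tuple is a tuple over \<open>C B\<close> together with a tuple over
  \<open>B\<close>, and the generation condition concerns only the latter.\<close>

lemma card_twisted_tuples:
  assumes B: "subgroup B K" and t: "t \<in> carrier A"
  shows "card (twisted_tuples r B (twisted B t)) = card (C B) ^ r * num_generating_tuples K r B"
proof -
  interpret B: subgroup B K by fact
  define g where "g = (\<lambda>(c, b). (c \<otimes> coboundary t b, b))"
  define Cs where "Cs = {cs. set cs \<subseteq> C B \<and> length cs = r}"
  define Bs where "Bs = {bs. length bs = r \<and> set bs \<subseteq> B \<and> generate K (set bs) = B}"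
  have inj: "inj_on g (C B \<times> B)"
    unfolding g_def by (rule inj_on_twist [OF B.subset t])
  have snd_g: "snd (g x) = snd x" for x
    by (simp add: g_def case_prod_unfold)
  have zip_sub: "set (zip cs bs) \<subseteq> C B \<times> B" if "cs \<in> Cs" "bs \<in> Bs" for cs bs
  proof clarify
    fix c b assume "(c, b) \<in> set (zip cs bs)"
    then have "c \<in> set cs \<and> b \<in> set bs"
      using set_zip_leftD set_zip_rightD by metis
    with that show "c \<in> C B \<and> b \<in> B"
      unfolding Cs_def Bs_def by blast
  qed
  have "bij_betw (\<lambda>(cs, bs). map g (zip cs bs)) (Cs \<times> Bs) (twisted_tuples r B (twisted B t))"
  proof (rule bij_betw_imageI)
    show "inj_on (\<lambda>(cs, bs). map g (zip cs bs)) (Cs \<times> Bs)"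
    proof (rule inj_onI, clarify)
      fix cs bs cs' bs'
      assume *: "cs \<in> Cs" "bs \<in> Bs" "cs' \<in> Cs" "bs' \<in> Bs" "map g (zip cs bs) = map g (zip cs' bs')"
      have "set (zip cs bs) \<union> set (zip cs' bs') \<subseteq> C B \<times> B"
        using zip_sub * by blast
      then have eq: "zip cs bs = zip cs' bs'"
        using *(5) inj_on_subset [OF inj] by (simp add: inj_on_map_eq_map)
      \<comment> \<open>Equal lengths ensure that unzipping recovers both lists.\<close>
      have len: "length cs = length bs" "length cs' = length bs'"
        using * by (auto simp: Cs_def Bs_def)
      have "cs = map fst (zip cs' bs')" "bs = map snd (zip cs' bs')"
        using len(1) by (simp_all flip: eq)
      then show "cs = cs' \<and> bs = bs'"
        using len(2) by simp
    qed
    show "(\<lambda>(cs, bs). map g (zip cs bs)) ` (Cs \<times> Bs) = twisted_tuples r B (twisted B t)"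
    proof (intro equalityI subsetI)
      fix xs assume "xs \<in> (\<lambda>(cs, bs). map g (zip cs bs)) ` (Cs \<times> Bs)"
      then obtain cs bs where xs: "cs \<in> Cs" "bs \<in> Bs" "xs = map g (zip cs bs)"
        by auto
      then have len: "length cs = r" "length bs = r"
        by (auto simp: Cs_def Bs_def)
      have "snd ` set xs = set (map snd (zip cs bs))"
        by (simp add: xs(3) image_image snd_g)
      also have "\<dots> = set bs"
        using len by (simp only: map_snd_zip)
      finally have "generate K (snd ` set xs) = B"
        using xs(2) by (simp add: Bs_def)
      moreover have "set xs \<subseteq> twisted B t"
        using zip_sub [OF xs(1,2)] unfolding xs(3) twisted_def g_def by auto
      ultimately show "xs \<in> twisted_tuples r B (twisted B t)"
        using len by (simp add: twisted_tuples_def xs(3))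
    next
      fix xs assume xs: "xs \<in> twisted_tuples r B (twisted B t)"
      \<comment> \<open>Pulls each entry back along \<open>g\<close>; the preimage of
        \<open>xs\<close> is then found by unzipping \<open>ys\<close>.\<close>
      define ys where "ys = map (the_inv_into (C B \<times> B) g) xs"
      have img: "set xs \<subseteq> g ` (C B \<times> B)"
        using xs by (simp add: twisted_tuples_def twisted_def g_def)
      then have ys: "set ys \<subseteq> C B \<times> B"
        unfolding ys_def set_map using the_inv_into_into [OF inj _ subset_refl] by blast
      have xs_eq: "xs = map g ys"
        unfolding ys_def map_map using img
        by (intro map_idI [symmetric]) (simp add: f_the_inv_into_f [OF inj] subsetD)
      have "snd ` set xs = set (map snd ys)"
        by (simp add: xs_eq image_image snd_g)
      then have "map fst ys \<in> Cs" "map snd ys \<in> Bs"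
        using xs ys by (auto simp: Cs_def Bs_def twisted_tuples_def ys_def)
      moreover have "xs = map g (zip (map fst ys) (map snd ys))"
        by (simp add: xs_eq zip_map_fst_snd)
      ultimately show "xs \<in> (\<lambda>(cs, bs). map g (zip cs bs)) ` (Cs \<times> Bs)"
        by (intro image_eqI [of _ _ "(map fst ys, map snd ys)"]) auto
    qed
  qed
  then have "card (twisted_tuples r B (twisted B t)) = card (Cs \<times> Bs)"
    by (rule bij_betw_same_card [symmetric])
  also have "\<dots> = card Cs * card Bs"
    by (rule card_cartesian_product)
  also have "card Cs = card (C B) ^ r"
    unfolding Cs_def using finite_A
    by (intro card_lists_length_eq finite_subset [of "C B" "carrier A"]) (auto simp: C_carrier)
  finally show ?thesis
    by (simp add: Bs_def num_generating_tuples_def)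
qed

text \<open>The averaging argument needs an element over every \<open>b \<in> B\<close>, so it is
  applied to the subgroup generated by the tuple, which is abelian. Conversely, each conjugate is
  abelian.\<close>

lemma commuting_tuples_eq_UN:
  "commuting_tuples r G
    = (\<Union>B \<in> {B. subgroup B K}. \<Union>H \<in> twisted B ` carrier A. twisted_tuples r B H)"
proof (intro equalityI subsetI)
  fix xs assume "xs \<in> commuting_tuples r G"
  then have len: "length xs = r" and xs: "set xs \<subseteq> carrier G"
    and comm: "\<And>x y. x \<in> set xs \<Longrightarrow> y \<in> set xs \<Longrightarrow> x \<otimes>\<^bsub>G\<^esub> y = y \<otimes>\<^bsub>G\<^esub> x"
    by (auto simp: commuting_tuples_iff)
  define B where "B = generate K (snd ` set xs)"
  have "snd ` set xs \<subseteq> carrier K"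
    using xs by (auto simp: semidirect_def)
  then have B: "subgroup B K"
    unfolding B_def by (rule K.generate_is_subgroup)
  \<comment> \<open>A homomorphism maps the generated subgroup onto the subgroup generated by the
    images.\<close>
  have proj: "snd ` generate G (set xs) = B"
    unfolding B_def using group_hom.generate_img [OF snd_hom xs] by simp
  obtain t where "t \<in> carrier A" "generate G (set xs) \<subseteq> twisted B t"
    using commuting_subset_twisted [OF B G.generate_incl [OF xs] proj]
      G.generate_pairwise_commute [OF xs comm] by blast
  moreover from this have "set xs \<subseteq> twisted B t"
    using generate.incl [of _ "set xs" G] by auto
  ultimately show "xs \<in> (\<Union>B \<in> {B. subgroup B K}. \<Union>H \<in> twisted B ` carrier A. twisted_tuples r B H)"
    using B len by (auto simp: twisted_tuples_def B_def)
next
  fix xs assume "xs \<in> (\<Union>B \<in> {B. subgroup B K}. \<Union>H \<in> twisted B ` carrier A. twisted_tuples r B H)"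
  then obtain B t where "subgroup B K" "t \<in> carrier A" "length xs = r" "set xs \<subseteq> twisted B t"
    by (auto simp: twisted_tuples_def)
  moreover from this have "twisted B t \<subseteq> carrier G"
    "\<forall>x\<in>twisted B t. \<forall>y\<in>twisted B t. x \<otimes>\<^bsub>G\<^esub> y = y \<otimes>\<^bsub>G\<^esub> x"
    using twisted_abelian subgroup.subset unfolding G.abelian_subgroups_iff by blast+
  ultimately show "xs \<in> commuting_tuples r G"
    unfolding commuting_tuples_iff by blast
qed

text \<open>Both conjugates contain the subgroup generated by \<open>xs\<close>, which projects onto
  \<open>B\<close>, so \<open>twisted_common\<close> applies to it.\<close>

lemma twisted_tuples_disjoint:
  assumes B: "subgroup B K" and t: "t \<in> carrier A" "t' \<in> carrier A"
    and xs: "xs \<in> twisted_tuples r B (twisted B t)" "xs \<in> twisted_tuples r B (twisted B t')"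
  shows "twisted B t = twisted B t'"
proof -
  have sub: "subgroup (twisted B t) G" "subgroup (twisted B t') G"
    using twisted_abelian [OF B] t by (auto simp: G.abelian_subgroups_iff)
  have in_t: "set xs \<subseteq> twisted B t" "set xs \<subseteq> twisted B t'"
    and gen: "generate K (snd ` set xs) = B"
    using xs by (auto simp: twisted_tuples_def)
  have "set xs \<subseteq> carrier G"
    using in_t subgroup.subset [OF sub(1)] by auto
  then have "snd ` generate G (set xs) = B"
    using group_hom.generate_img [OF snd_hom] gen by simp
  then have "t \<otimes> inv t' \<in> C B"
    by (intro twisted_common [OF B t, of "generate G (set xs)"]
        G.generate_subgroup_incl [OF in_t(1) sub(1)] G.generate_subgroup_incl [OF in_t(2) sub(2)])
  then show ?thesis
    by (rule twisted_cong [OF B t])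
qed

text \<open>Both unions are disjoint: a tuple determines \<open>B\<close> as the subgroup generated
  by its projections, and then its conjugate. The index counts the conjugates for a given
  \<open>B\<close>.\<close>

theorem card_commuting_tuples:
  "card (commuting_tuples r G) =
    (\<Sum>B \<in> {B. subgroup B K}.
       subgroup_index A (C B) * card (C B) ^ r * num_generating_tuples K r B)"
proof -
  have carr: "H \<subseteq> carrier G" if "subgroup B K" "H \<in> twisted B ` carrier A" for B H
    using that twisted_carrier subgroup.subset by blast
  have "card (commuting_tuples r G) =
    (\<Sum>B \<in> {B. subgroup B K}. card (\<Union>H \<in> twisted B ` carrier A. twisted_tuples r B H))"
    unfolding commuting_tuples_eq_UN
  proof (rule card_UN_disjoint)
    show "finite {B. subgroup B K}"
      by (rule K.finite_subgroups [OF finite_K])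
    show "\<forall>B \<in> {B. subgroup B K}. finite (\<Union>H \<in> twisted B ` carrier A. twisted_tuples r B H)"
      using finite_A carr by (auto intro!: finite_twisted_tuples)
  qed (auto simp: twisted_tuples_def)
  also have "\<dots> = (\<Sum>B \<in> {B. subgroup B K}.
       subgroup_index A (C B) * card (C B) ^ r * num_generating_tuples K r B)"
  proof (rule sum.cong [OF refl])
    fix B assume "B \<in> {B. subgroup B K}"
    then have B: "subgroup B K"
      by simp
    have "card (\<Union>H \<in> twisted B ` carrier A. twisted_tuples r B H)
      = (\<Sum>H \<in> twisted B ` carrier A. card (twisted_tuples r B H))"
    proof (rule card_UN_disjoint)
      show "finite (twisted B ` carrier A)"
        using finite_A by simp
      show "\<forall>H \<in> twisted B ` carrier A. finite (twisted_tuples r B H)"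
        by (intro ballI finite_twisted_tuples carr [OF B])
      show "\<forall>H \<in> twisted B ` carrier A. \<forall>H' \<in> twisted B ` carrier A. H \<noteq> H' \<longrightarrow>
          twisted_tuples r B H \<inter> twisted_tuples r B H' = {}"
      proof (intro ballI impI equals0I)
        fix H H' xs
        assume "H \<in> twisted B ` carrier A" "H' \<in> twisted B ` carrier A" "H \<noteq> H'"
          and xs: "xs \<in> twisted_tuples r B H \<inter> twisted_tuples r B H'"
        then obtain t t' where t: "t \<in> carrier A" "t' \<in> carrier A"
          and H: "H = twisted B t" "H' = twisted B t'"
          by blast
        have "H = H'"
          using xs unfolding H by (intro twisted_tuples_disjoint [OF B t]) auto
        with \<open>H \<noteq> H'\<close> show False ..
      qed
    qed
    also have "\<dots> = (\<Sum>H \<in> twisted B ` carrier A. card (C B) ^ r * num_generating_tuples K r B)"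
      using card_twisted_tuples [OF B] by (intro sum.cong) auto
    finally show "card (\<Union>H \<in> twisted B ` carrier A. twisted_tuples r B H)
      = subgroup_index A (C B) * card (C B) ^ r * num_generating_tuples K r B"
      by (simp add: card_twisted_image [OF B])
  qed
  finally show ?thesis .
qed

section \<open>Abelian subgroups of maximal order\<close>

text \<open>With \<open>B\<close> the projection of a maximal \<open>H\<close>, some abelian
  \<open>twisted B t\<close> contains \<open>H\<close>, and maximality forces equality.\<close>

lemma max_abelian_eq_UN:
  "{H \<in> abelian_subgroups G. card H = max_abelian_order G}
    = (\<Union>B \<in> {B. subgroup B K \<and> card (C B) * card B = max_abelian_order G}. twisted B ` carrier A)"
proof (intro equalityI subsetI)
  fix H assume "H \<in> {H \<in> abelian_subgroups G. card H = max_abelian_order G}"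
  then have H: "H \<in> abelian_subgroups G" and max: "card H = max_abelian_order G"
    by auto
  then have sub: "subgroup H G" and comm: "\<And>x y. x \<in> H \<Longrightarrow> y \<in> H \<Longrightarrow> x \<otimes>\<^bsub>G\<^esub> y = y \<otimes>\<^bsub>G\<^esub> x"
    by (auto simp: G.abelian_subgroups_iff)
  define B where "B = snd ` H"
  have B: "subgroup B K"
    unfolding B_def by (rule group_hom.subgroup_img_is_subgroup [OF snd_hom sub])
  obtain t where t: "t \<in> carrier A" "H \<subseteq> twisted B t"
    using commuting_subset_twisted [OF B subgroup.subset [OF sub] B_def [symmetric] comm] by blast
  have "abelian_subgroups G \<subseteq> {H. subgroup H G}"
    by (auto simp: abelian_subgroups_def)
  then have fin: "finite (abelian_subgroups G)"
    using G.finite_subgroups [OF finite_G] finite_subset by blast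
  have "card (twisted B t) \<le> max_abelian_order G"
    unfolding max_abelian_order_def using fin twisted_abelian [OF B t(1)] by (intro Max_ge) auto
  moreover have "finite (twisted B t)"
    using finite_subset [OF twisted_carrier finite_G] B t(1) subgroup.subset by blast
  ultimately have "H = twisted B t"
    using t(2) max card_seteq by metis
  then show "H \<in> (\<Union>B \<in> {B. subgroup B K \<and> card (C B) * card B = max_abelian_order G}.
      twisted B ` carrier A)"
    using B t(1) max card_twisted [OF subgroup.subset [OF B] t(1)] by auto
next
  fix H assume "H \<in> (\<Union>B \<in> {B. subgroup B K \<and> card (C B) * card B = max_abelian_order G}.
      twisted B ` carrier A)"
  then obtain B t where B: "subgroup B K" "card (C B) * card B = max_abelian_order G"
    and t: "t \<in> carrier A" "H = twisted B t"
    by auto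
  then show "H \<in> {H \<in> abelian_subgroups G. card H = max_abelian_order G}"
    using twisted_abelian [OF B(1) t(1)] card_twisted [OF subgroup.subset [OF B(1)] t(1)] by simp
qed

text \<open>Conjugates for different \<open>B\<close> differ because their projections do, so the
  index counts for the individual \<open>B\<close> add up.\<close>

theorem num_max_abelian_eq:
  "num_max_abelian G =
    (\<Sum>B \<in> {B. subgroup B K \<and> card (C B) * card B = max_abelian_order G}. subgroup_index A (C B))"
proof -
  have "num_max_abelian G = (\<Sum>B \<in> {B. subgroup B K \<and> card (C B) * card B = max_abelian_order G}.
      card (twisted B ` carrier A))"
    unfolding num_max_abelian_def max_abelian_eq_UN
  proof (rule card_UN_disjoint)
    show "finite {B. subgroup B K \<and> card (C B) * card B = max_abelian_order G}"
      by (rule finite_subset [OF _ K.finite_subgroups [OF finite_K]]) auto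
    have "B = B'" if "subgroup B K" "subgroup B' K" "twisted B t = twisted B' t'" for B B' t t'
      using that snd_twisted by metis
    then show "\<forall>B \<in> {B. subgroup B K \<and> card (C B) * card B = max_abelian_order G}.
       \<forall>B' \<in> {B. subgroup B K \<and> card (C B) * card B = max_abelian_order G}. B \<noteq> B' \<longrightarrow>
         twisted B ` carrier A \<inter> twisted B' ` carrier A = {}"
      by blast
  qed (use finite_A in auto)
  then show ?thesis
    by (simp add: card_twisted_image)
qed

end

theorem corollary4p6:
  fixes A :: "('a, 'm) monoid_scheme"
    and K :: "('b, 'n) monoid_scheme"
    and \<theta> :: "'b \<Rightarrow> 'a \<Rightarrow> 'a"
    and G :: "('a \<times> 'b) monoid"
    and C :: "'b set \<Rightarrow> 'a set"
  assumes "comm_group A" and "finite (carrier A)"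
    and "comm_group K" and "finite (carrier K)"
    and "\<theta> \<in> hom K (AutoGroup A)"
    and "coprime (order A) (order K)"
  defines "G \<equiv> semidirect A \<theta> K"
    and "C \<equiv> fixed_points A \<theta>"
  shows
    "(\<forall>r\<ge>1.
        card (commuting_tuples r G) =
          (\<Sum>B \<in> {B. subgroup B K}.
             subgroup_index A (C B) * card (C B) ^ r * num_generating_tuples K r B) \<and>
        card (commuting_tuples r G) =
          order A * (\<Sum>B \<in> {B. subgroup B K}.
             card (C B) ^ (r - 1) * num_generating_tuples K r B) \<and>
        int (card (commuting_tuples r G)) =
          (\<Sum>B \<in> {B. subgroup B K}. \<Sum>D \<in> {D. subgroup D K \<and> D \<subseteq> B}.
             int (subgroup_index A (C B)) * subgroup_moebius K D B
               * int (card (C B) * card D) ^ r)) \<and>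
     num_max_abelian G =
       (\<Sum>B \<in> {B. subgroup B K \<and> card (C B) * card B = max_abelian_order G}.
          subgroup_index A (C B))"
proof -
  interpret coprime_action A K \<theta>
    using assms(1-6) by (intro coprime_action.intro coprime_action_axioms.intro)
  have index: "subgroup_index A (C B) * card (C B) = order A" if "subgroup B K" for B
    using A.lagrange [OF subgroup_C [OF subgroup.subset [OF that]]]
    by (simp add: C_def subgroup_index_def)
  have first: "card (commuting_tuples r G) =
      (\<Sum>B \<in> {B. subgroup B K}.
         subgroup_index A (C B) * card (C B) ^ r * num_generating_tuples K r B)" for r
    unfolding G_def C_def by (rule card_commuting_tuples)
  have second: "card (commuting_tuples r G) =
      order A * (\<Sum>B \<in> {B. subgroup B K}.
         card (C B) ^ (r - 1) * num_generating_tuples K r B)" if "r \<ge> 1" for r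
  proof -
    \<comment> \<open>As \<open>r \<ge> 1\<close>, one factor \<open>card (C B)\<close> can be split
      off; with the index it makes up \<open>order A\<close> by Lagrange.\<close>
    have "card (C B) ^ r = card (C B) * card (C B) ^ (r - 1)" for B
      using that by (cases r) auto
    then show ?thesis
      unfolding first sum_distrib_left using index
      by (intro sum.cong) (auto simp flip: mult.assoc)
  qed
  \<comment> \<open>The Moebius expansion of the number of generating tuples is inserted into the
    first formula, and the two \<open>r\<close>-th powers are merged.\<close>
  have third: "int (card (commuting_tuples r G)) =
      (\<Sum>B \<in> {B. subgroup B K}. \<Sum>D \<in> {D. subgroup D K \<and> D \<subseteq> B}.
         int (subgroup_index A (C B)) * subgroup_moebius K D B * int (card (C B) * card D) ^ r)" for r
    unfolding first
    by (auto simp: K.num_generating_tuples_moebius [OF assms(4)] sum_distrib_left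
        power_mult_distrib mult_ac intro!: sum.cong)
  have fourth: "num_max_abelian G =
      (\<Sum>B \<in> {B. subgroup B K \<and> card (C B) * card B = max_abelian_order G}.
         subgroup_index A (C B))"
    unfolding G_def C_def by (rule num_max_abelian_eq)
  show ?thesis
    using first second third fourth by blast
qed

end
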